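(* Let $\{(\bm{x}^k,\bm{\lambda}^k,\bm{\rho}^k)\}_{k\ge 0}$ be generated by Algorithm I (described in the context). Assume that each $f_i:\mathbb{R}^D\to\mathbb{R}$ is convex and continuously differentiable, and that the Lagrangian $L(\bm{x},\bm{\lambda})=f(\bm{x})+\bm{\lambda}^TA\bm{x}$ has a saddle point, i.e. a pair $(\bm{x}^*,\bm{\lambda}^* )$ with $L(\bm{x}^*,\bm{\lambda})\le L(\bm{x}^*,\bm{\lambda}^* )\le L(\bm{x},\bm{\lambda}^* )$ for all $\bm{x}\in\mathbb{R}^{ND}$, $\bm{\lambda}\in\mathbb{R}^{|E|D}$. Suppose there is a symmetric matrix $\bar{\bm{\rho}}\in\mathbb{R}^{|E|D\times|E|D}$ such that Condition A: $0\prec\bm{\rho}^0\preceq\bm{\rho}^k\preceq\bm{\rho}^{k+1}\preceq\bar{\bm{\rho}}$ for all $k\ge 0$; Condition B: $Q_P+Q_C^k\succ A^T\bar{\bm{\rho}}A$ (for all $k\ge 0$; note $Q_C^k=I_{ND}$). Then Algorithm I converges to an optimal solution of $$\min_{\bm{x}\in\mathbb{R}^{ND}} f(\bm{x})\quad\text{subject to}\quad A\bm{x}=\bm{0},$$ i.e. the sequence $\{\bm{x}^k\}$ converges to an optimal solution of this problem.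
   Context: Setting. $G=(V,E)$ is a connected undirected graph with vertex set $V=\{1,\dots,N\}$ (agents); each edge is written $e_{i,j}$ with $i<j$. $\mathcal{N}_i$ denotes the set consisting of $i$ itself and all neighbors of $i$ (so $i\in\mathcal{N}_i$, but $e_{i,i}\notin E$). Each agent $i$ has a function $f_i:\mathbb{R}^D\to\mathbb{R}$; $\bm{x}=[\bm{x}_1^T,\dots,\bm{x}_N^T]^T\in\mathbb{R}^{ND}$ with $\bm{x}_i\in\mathbb{R}^D$, and $f(\bm{x})=\sum_{i=1}^N f_i(\bm{x}_i)$. $A=[a_{m,n}]\otimes I_D\in\mathbb{R}^{|E|D\times ND}$ is the edge-node incidence matrix: if the $m$th edge is $e_{i,j}$ ($i<j$) then $a_{m,i}=1$, $a_{m,j}=-1$, and $a_{m,n}=0$ otherwise. Thus $A\bm{x}=\bm{0}$ says $\bm{x}_i=\bm{x}_j$ for every edge. Penalties and multipliers. At iteration $k$ there are scalars $\rho_{i,j}^k=\rho_{j,i}^k>0$ for each edge, and $\rho_{i,i}^k:=1-\sum_{j\in\mathcal{N}_i,\,j\ne i}\rho_{i,j}^k$. Put $\bm{\rho}^k=\mathrm{diag}\{\rho_{i,j}^kI_D\}_{e_{i,j}\in E}\in\mathbb{R}^{|E|D\times|E|D}$ (blocks in the order of the edges). Multipliers $\bm{\lambda}_{i,j}^k\in\mathbb{R}^D$ satisfy $\bm{\lambda}_{j,i}^k=-\bm{\lambda}_{i,j}^k$, $\bm{\lambda}_{i,i}^k=\bm{0}$, and $\bm{\lambda}^k=[\bm{\lambda}_{i,j}^k]_{e_{i,j}\in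 E}\in\mathbb{R}^{|E|D}$. Algorithm I. Constants $\gamma_i>0$ ($i=1,\dots,N$) and arbitrary $\bm{x}^0$ are given, and $\bm{\lambda}_{i,j}^0=\rho_{i,j}^0(\bm{x}_i^0-\bm{x}_j^0)$. For $k=0,1,2,\dots$, for every $i$ (in parallel), $$\bm{x}_i^{k+1}\in\operatorname{argmin}_{\bm{x}_i\in\mathbb{R}^D}\Big\{f_i(\bm{x}_i)+\tfrac{\gamma_i}{2}\|\bm{x}_i-\bm{x}_i^k\|^2+\sum_{j\in\mathcal{N}_i}\big((\bm{\lambda}_{i,j}^k)^T\bm{x}_i+\tfrac{\rho_{i,j}^k}{2}\|\bm{x}_i-\bm{x}_j^k\|^2\big)\Big\},$$ then the penalties are updated from $\rho_{i,j}^k$ to $\rho_{i,j}^{k+1}$, and $\bm{\lambda}_{i,j}^{k+1}=\bm{\lambda}_{i,j}^k+\rho_{i,j}^{k+1}(\bm{x}_i^{k+1}-\bm{x}_j^{k+1})$ for $j\in\mathcal{N}_i$. Matrices. $Q_P=\mathrm{diag}\{\gamma_1,\dots,\gamma_N\}\otimes I_D$ and $Q_C^k=\mathrm{diag}\{\sum_{j\in\mathcal{N}_1}\rho_{1,j}^k,\dots,\sum_{j\in\mathcal{N}_N}\rho_{N,j}^k\}\otimes I_D$, which equals $I_{ND}$ by the choice of $\rho_{i,i}^k$. For symmetric matrices, $M_1\preceq M_2$ (resp. $M_1\prec M_2$) means $M_2-M_1$ is positive semidefinite (resp. positive definite). *)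

theory Defs
  imports "HOL-Analysis.Analysis"
begin

(* Agents are the elements of a finite linearly ordered type 'n (N = CARD('n)) and R^D is real^'d,
   so R^(ND) is real^('n * 'd), with coordinate (i, d) being coordinate d of agent i.
   The order on 'n serves only to orient edges. *)

definition block :: "real^('n::finite \<times> 'd::finite) \<Rightarrow> 'n \<Rightarrow> real^'d" where
  "block x i = (\<chi> d. x $ (i, d))"

definition kronecker :: "real^'b::finite^'a::finite \<Rightarrow> real^'d::finite^'c::finite \<Rightarrow> real^('b \<times> 'd)^('a \<times> 'c)" where
  "kronecker M P = (\<chi> p q. M $ fst p $ fst q * P $ snd p $ snd q)"

definition diag :: "('a \<Rightarrow> real) \<Rightarrow> real^'a::finite^'a" where
  "diag v = (\<chi> i j. if i = j then v i else 0)"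

(* An undirected edge between i < j is the single pair (i, j). *)

definition connected_graph :: "('n::linorder \<times> 'n) set \<Rightarrow> bool" where
  "connected_graph E \<longleftrightarrow> (\<forall>(i, j)\<in>E. i < j) \<and> (\<forall>i j. (i, j) \<in> (E \<union> E\<inverse>)\<^sup>*)"

definition nbrs :: "('n \<times> 'n) set \<Rightarrow> 'n \<Rightarrow> 'n set" where
  "nbrs E i = insert i {j. (i, j) \<in> E \<or> (j, i) \<in> E}"

(* Spaces indexed by the edge set. E is a variable, possibly empty, so R^(|E|D) is represented by
   the vectors indexed by all pairs ('n * 'n) that vanish at the pairs outside E, and
   R^(|E|D x |E|D) by the matrices that vanish outside E x E. This is the literal space, with rows
   named by their edges rather than numbered, and padded with zeros. Definiteness is therefore
   taken relative to the subspace of vectors concerned. *)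

definition edge_vecs :: "('n \<times> 'n) set \<Rightarrow> (real^(('n::finite \<times> 'n) \<times> 'd::finite)) set" where
  "edge_vecs E = {v. \<forall>p. fst p \<notin> E \<longrightarrow> v $ p = 0}"

definition edge_mats ::
  "('n \<times> 'n) set \<Rightarrow> (real^(('n::finite \<times> 'n) \<times> 'd::finite)^(('n \<times> 'n) \<times> 'd)) set" where
  "edge_mats E = {M. \<forall>p q. fst p \<notin> E \<or> fst q \<notin> E \<longrightarrow> M $ p $ q = 0}"

definition loewner_le :: "(real^'a::finite) set \<Rightarrow> real^'a^'a \<Rightarrow> real^'a^'a \<Rightarrow> bool" where
  "loewner_le S M1 M2 \<longleftrightarrow> (\<forall>v\<in>S. 0 \<le> v \<bullet> ((M2 - M1) *v v))"

definition loewner_less :: "(real^'a::finite) set \<Rightarrow> real^'a^'a \<Rightarrow> real^'a^'a \<Rightarrow> bool" where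
  "loewner_less S M1 M2 \<longleftrightarrow> (\<forall>v\<in>S. v \<noteq> 0 \<longrightarrow> 0 < v \<bullet> ((M2 - M1) *v v))"

definition incidence :: "('n \<times> 'n) set \<Rightarrow> real^('n::finite \<times> 'd::finite)^(('n \<times> 'n) \<times> 'd)" where
  "incidence E = kronecker
     (\<chi> m n. if m \<in> E then (if n = fst m then 1 else if n = snd m then - 1 else 0) else 0)
     (mat 1)"

definition penalty_mat :: "('n \<times> 'n) set \<Rightarrow> ('n \<Rightarrow> 'n \<Rightarrow> real) \<Rightarrow>
    real^(('n::finite \<times> 'n) \<times> 'd::finite)^(('n \<times> 'n) \<times> 'd)" where
  "penalty_mat E r = kronecker (diag (\<lambda>m. if m \<in> E then r (fst m) (snd m) else 0)) (mat 1)"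

definition Q_P :: "('n \<Rightarrow> real) \<Rightarrow> real^('n::finite \<times> 'd::finite)^('n \<times> 'd)" where
  "Q_P \<gamma> = kronecker (diag \<gamma>) (mat 1)"

definition Q_C :: "('n \<times> 'n) set \<Rightarrow> ('n \<Rightarrow> 'n \<Rightarrow> real) \<Rightarrow>
    real^('n::finite \<times> 'd::finite)^('n \<times> 'd)" where
  "Q_C E r = kronecker (diag (\<lambda>i. \<Sum>j\<in>nbrs E i. r i j)) (mat 1)"

definition continuously_differentiable :: "(real^'d::finite \<Rightarrow> real) \<Rightarrow> bool" where
  "continuously_differentiable g \<longleftrightarrow>
     (\<exists>g'. (\<forall>z. GDERIV g z :> g' z) \<and> continuous_on UNIV g')"

definition objective :: "('n \<Rightarrow> real^'d \<Rightarrow> real) \<Rightarrow> real^('n::finite \<times> 'd::finite) \<Rightarrow> real" where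
  "objective f x = (\<Sum>i\<in>UNIV. f i (block x i))"

definition lagrangian :: "('n \<times> 'n) set \<Rightarrow> ('n \<Rightarrow> real^'d \<Rightarrow> real) \<Rightarrow>
    real^('n::finite \<times> 'd::finite) \<Rightarrow> real^(('n \<times> 'n) \<times> 'd) \<Rightarrow> real" where
  "lagrangian E f x l = objective f x + l \<bullet> (incidence E *v x)"

definition saddle_point :: "('n \<times> 'n) set \<Rightarrow> ('n \<Rightarrow> real^'d \<Rightarrow> real) \<Rightarrow>
    real^('n::finite \<times> 'd::finite) \<Rightarrow> real^(('n \<times> 'n) \<times> 'd) \<Rightarrow> bool" where
  "saddle_point E f xs ls \<longleftrightarrow> ls \<in> edge_vecs E \<and>
     (\<forall>x. \<forall>l\<in>edge_vecs E.
        lagrangian E f xs l \<le> lagrangian E f xs ls \<and>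
        lagrangian E f xs ls \<le> lagrangian E f x ls)"

definition optimal_solution :: "('n \<times> 'n) set \<Rightarrow> ('n \<Rightarrow> real^'d \<Rightarrow> real) \<Rightarrow>
    real^('n::finite \<times> 'd::finite) \<Rightarrow> bool" where
  "optimal_solution E f xs \<longleftrightarrow> is_arg_min (objective f) (\<lambda>x. incidence E *v x = 0) xs"

(* The values of \<rho> and \<lambda> at pairs that are neither edges nor diagonal play no role. *)

definition admissible_penalties :: "('n \<times> 'n) set \<Rightarrow> ('n \<Rightarrow> 'n \<Rightarrow> real) \<Rightarrow> bool" where
  "admissible_penalties E r \<longleftrightarrow>
     (\<forall>(i, j)\<in>E. r i j = r j i \<and> 0 < r i j) \<and>
     (\<forall>i. r i i = 1 - (\<Sum>j\<in>nbrs E i - {i}. r i j))"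

definition local_objective :: "('n \<times> 'n) set \<Rightarrow> ('n \<Rightarrow> real^'d \<Rightarrow> real) \<Rightarrow> ('n \<Rightarrow> real) \<Rightarrow>
    real^('n::finite \<times> 'd::finite) \<Rightarrow> ('n \<Rightarrow> 'n \<Rightarrow> real^'d) \<Rightarrow> ('n \<Rightarrow> 'n \<Rightarrow> real) \<Rightarrow>
    'n \<Rightarrow> real^'d \<Rightarrow> real" where
  "local_objective E f \<gamma> x l r i z =
     f i z + \<gamma> i / 2 * (norm (z - block x i))\<^sup>2 +
     (\<Sum>j\<in>nbrs E i. l i j \<bullet> z + r i j / 2 * (norm (z - block x j))\<^sup>2)"

definition algorithm_I :: "('n \<times> 'n) set \<Rightarrow> ('n \<Rightarrow> real^'d \<Rightarrow> real) \<Rightarrow> ('n \<Rightarrow> real) \<Rightarrow>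
    (nat \<Rightarrow> real^('n::finite \<times> 'd::finite)) \<Rightarrow> (nat \<Rightarrow> 'n \<Rightarrow> 'n \<Rightarrow> real^'d) \<Rightarrow>
    (nat \<Rightarrow> 'n \<Rightarrow> 'n \<Rightarrow> real) \<Rightarrow> bool" where
  "algorithm_I E f \<gamma> x l r \<longleftrightarrow>
     (\<forall>k. admissible_penalties E (r k)) \<and>
     (\<forall>k. (\<forall>(i, j)\<in>E. l k j i = - l k i j) \<and> (\<forall>i. l k i i = 0)) \<and>
     (\<forall>i. \<forall>j\<in>nbrs E i. l 0 i j = r 0 i j *\<^sub>R (block (x 0) i - block (x 0) j)) \<and>
     (\<forall>k i. is_arg_min (local_objective E f \<gamma> (x k) (l k) (r k) i) (\<lambda>_. True)
                (block (x (Suc k)) i)) \<and>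
     (\<forall>k i. \<forall>j\<in>nbrs E i. l (Suc k) i j =
        l k i j + r (Suc k) i j *\<^sub>R (block (x (Suc k)) i - block (x (Suc k)) j))"

end

theory Submission
  imports Defs
begin

text \<open>
  Write \<open>G\<close> for the gradient of the objective, \<open>P\<^sub>k\<close> for the diagonal penalty matrix at step \<open>k\<close> and
  \<open>Q = Q_P + I\<close>. Because every agent's penalties, its own included, sum to one, the optimality
  conditions of the \<open>N\<close> local minimisations combine into a single equation
  (\<open>agent_step_stationarity\<close>, \<open>transpose_incidence_nth\<close>):
  \<open>G(x') + Q(x' - x) + A\<^sup>T(\<lambda> + P\<^sub>k A x) = 0\<close>, where \<open>x\<close>, \<open>\<lambda>\<close> are the iterates at step \<open>k\<close> and \<open>x'\<close> is
  the next one. Together with \<open>\<lambda>' = \<lambda> + P\<^sub>k\<^sub>+\<^sub>1 A x'\<close> this is a preconditioned primal-dual iteration for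
  the KKT system \<open>G(x) + A\<^sup>T\<lambda> = 0\<close>, \<open>A x = 0\<close> of the continuous monotone operator \<open>G\<close>.

  The proof measures the distance to a KKT pair \<open>(x\<^sup>*, \<lambda>\<^sup>*)\<close> by
  \<open>V\<^sub>k = |x - x\<^sup>*|\<^sup>2\<close> in the \<open>Q\<close>-norm, plus \<open>|\<lambda> - \<lambda>\<^sup>*|\<^sup>2\<close> in the norm of the inverse of \<open>P\<^sub>k\<close>, minus
  \<open>A x \<bullet> P\<^sub>k A x\<close>. The last term looks dangerous, but as \<open>A x\<^sup>* = 0\<close> it equals the same form at
  \<open>x - x\<^sup>*\<close>, and Condition B says that \<open>Q\<close> dominates \<open>A\<^sup>T P\<^sub>k A\<close> with room to spare; so \<open>V\<^sub>k\<close> still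
  controls both distances (\<open>lyapunov_lower_bound\<close>). Monotonicity of \<open>G\<close>, the growth of the penalties
  and once more Condition B, applied to \<open>x' - x\<close>, show that \<open>V\<^sub>k\<close> decreases by at least
  \<open>A x' \<bullet> P\<^sub>k A x'\<close> plus a multiple of \<open>|x' - x|\<^sup>2\<close> (\<open>lyapunov_descent\<close>).

  Hence the iterates are bounded, \<open>x' - x\<close> and \<open>A x\<close> tend to zero, and every cluster point of
  \<open>(x, \<lambda>)\<close> is again a KKT pair. Measured from such a cluster point, \<open>V\<^sub>k\<close> is decreasing and has a
  subsequence tending to zero, so it tends to zero altogether and the whole sequence converges
  (\<open>primal_dual_convergence\<close>). The saddle point provides the first KKT pair
  (\<open>saddle_point_imp_KKT\<close>), and convexity makes the limit optimal (\<open>KKT_imp_optimal_solution\<close>).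
\<close>

section \<open>Primal-dual iterations for monotone operators\<close>

text \<open>
  The index set \<open>M\<close> numbers the scalar constraints \<open>a m \<bullet> x = 0\<close>, that is, \<open>a m\<close> is row \<open>m\<close> of \<open>A\<close>,
  and \<open>p\<close> is the diagonal of the penalty matrix.
\<close>

definition lyapunov ::
  "('x \<Rightarrow> 'x) \<Rightarrow> 'm set \<Rightarrow> ('m \<Rightarrow> 'x) \<Rightarrow> 'x \<Rightarrow> ('m \<Rightarrow> real) \<Rightarrow> ('m \<Rightarrow> real) \<Rightarrow> 'x::real_inner \<Rightarrow> ('m \<Rightarrow> real) \<Rightarrow> real"
where
  "lyapunov Q M a xs ls p x lam =
     (x - xs) \<bullet> Q (x - xs) + (\<Sum>m\<in>M. (lam m - ls m)\<^sup>2 / p m) - (\<Sum>m\<in>M. p m * (a m \<bullet> x)\<^sup>2)"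

text \<open>
  Put \<open>u = A y\<close> and \<open>v = A x\<close>. Pairing the difference of the two stationarity equations with
  \<open>y - xs\<close> gives \<open>(y - xs) \<bullet> Q (y - x) + u \<bullet> (lam - ls) + u \<bullet> p v \<le> 0\<close>. Each of the three products,
  doubled, is a combination of squares: the first by polarisation, the second from the multiplier
  update, the third through \<open>2 u v = u\<^sup>2 + v\<^sup>2 - (u - v)\<^sup>2\<close>. The negative terms are
  \<open>p' u\<^sup>2\<close>, which is part of the Lyapunov function, and \<open>p (u - v)\<^sup>2\<close>, which is absorbed by
  \<open>(y - x) \<bullet> Q (y - x)\<close>; replacing \<open>p\<close> by the larger \<open>p'\<close> below
  \<open>(lam - ls)\<^sup>2\<close> only helps.
\<close>
lemma lyapunov_descent:
  fixes G Q :: "'x::euclidean_space \<Rightarrow> 'x" and a :: "'m \<Rightarrow> 'x" and lam lam' ls p p' :: "'m \<Rightarrow> real"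
  assumes mono: "0 \<le> (G y - G xs) \<bullet> (y - xs)"
    and linQ: "linear Q" and symQ: "\<And>u v. u \<bullet> Q v = Q u \<bullet> v"
    and p0: "\<And>m. m \<in> M \<Longrightarrow> 0 < p m" and pp': "\<And>m. m \<in> M \<Longrightarrow> p m \<le> p' m"
    and dom: "\<And>z. (\<Sum>m\<in>M. p m * (a m \<bullet> z)\<^sup>2) + c * (norm z)\<^sup>2 \<le> z \<bullet> Q z"
    and step: "G y + Q (y - x) + (\<Sum>m\<in>M. (lam m + p m * (a m \<bullet> x)) *\<^sub>R a m) = 0"
    and lam': "\<And>m. m \<in> M \<Longrightarrow> lam' m = lam m + p' m * (a m \<bullet> y)"
    and feas: "\<And>m. m \<in> M \<Longrightarrow> a m \<bullet> xs = 0"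
    and stat: "G xs + (\<Sum>m\<in>M. ls m *\<^sub>R a m) = 0"
  shows "lyapunov Q M a xs ls p' y lam' + (\<Sum>m\<in>M. p m * (a m \<bullet> y)\<^sup>2) + c * (norm (y - x))\<^sup>2
    \<le> lyapunov Q M a xs ls p x lam"
proof -
  define u v where "u m = a m \<bullet> y" and "v m = a m \<bullet> x" for m
  have Gdiff: "G y - G xs = - Q (y - x) - (\<Sum>m\<in>M. (lam m - ls m + p m * v m) *\<^sub>R a m)"
  proof -
    have Gy: "G y = - Q (y - x) - (\<Sum>m\<in>M. (lam m + p m * v m) *\<^sub>R a m)"
      using step unfolding v_def by (simp add: eq_neg_iff_add_eq_0 algebra_simps)
    have Gxs: "G xs = - (\<Sum>m\<in>M. ls m *\<^sub>R a m)"
      using stat by (simp add: eq_neg_iff_add_eq_0)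
    show ?thesis
      unfolding Gy Gxs by (simp add: scaleR_add_left scaleR_diff_left sum.distrib sum_subtractf)
  qed
  have au: "a m \<bullet> (y - xs) = u m" if "m \<in> M" for m
    using feas[OF that] by (simp add: u_def inner_diff_right)
  have "0 \<le> - (Q (y - x) \<bullet> (y - xs)) - (\<Sum>m\<in>M. (lam m - ls m + p m * v m) * u m)"
  proof -
    have "(\<Sum>m\<in>M. (lam m - ls m + p m * v m) *\<^sub>R a m) \<bullet> (y - xs)
        = (\<Sum>m\<in>M. (lam m - ls m + p m * v m) * u m)"
      by (simp add: inner_sum_left au)
    then show ?thesis
      using mono unfolding Gdiff by (simp add: inner_diff_left)
  qed
  moreover have "2 * (Q (y - x) \<bullet> (y - xs)) = (y - xs) \<bullet> Q (y - xs) - (x - xs) \<bullet> Q (x - xs) + (y - x) \<bullet> Q (y - x)"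
  proof -
    define s t where "s = y - x" and "t = x - xs"
    have e: "y - xs = s + t" by (simp add: s_def t_def)
    have "t \<bullet> Q s = s \<bullet> Q t" using symQ[of t s] by (simp add: inner_commute)
    then show ?thesis
      unfolding e s_def[symmetric] t_def[symmetric] linear_add[OF linQ]
      by (simp add: inner_add_left inner_add_right inner_commute)
  qed
  moreover have "(\<Sum>m\<in>M. p m * (u m - v m)\<^sup>2) + c * (norm (y - x))\<^sup>2 \<le> (y - x) \<bullet> Q (y - x)"
    using dom[of "y - x"] by (simp add: u_def v_def inner_diff_right)
  moreover have "(\<Sum>m\<in>M. (lam' m - ls m)\<^sup>2 / p' m) - (\<Sum>m\<in>M. p' m * (u m)\<^sup>2) + (\<Sum>m\<in>M. p m * (u m)\<^sup>2)
      + (\<Sum>m\<in>M. p m * (v m)\<^sup>2)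
      \<le> (\<Sum>m\<in>M. (lam m - ls m)\<^sup>2 / p m) + 2 * (\<Sum>m\<in>M. (lam m - ls m + p m * v m) * u m) + (\<Sum>m\<in>M. p m * (u m - v m)\<^sup>2)"
  proof -
    have "(lam' m - ls m)\<^sup>2 / p' m - p' m * (u m)\<^sup>2 + p m * (u m)\<^sup>2 + p m * (v m)\<^sup>2
      \<le> (lam m - ls m)\<^sup>2 / p m + 2 * ((lam m - ls m + p m * v m) * u m) + p m * (u m - v m)\<^sup>2"
      if "m \<in> M" for m
    proof -
      have pos: "0 < p' m" "0 < p m" using p0 pp' that by force+
      have "(lam' m - ls m)\<^sup>2 / p' m = (lam m - ls m)\<^sup>2 / p' m + 2 * (lam m - ls m) * u m + p' m * (u m)\<^sup>2"
        using pos by (simp add: lam'[OF that] u_def[symmetric] field_simps power2_eq_square)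
      moreover have "(lam m - ls m)\<^sup>2 / p' m \<le> (lam m - ls m)\<^sup>2 / p m"
        using pos pp'[OF that] by (simp add: frac_le)
      ultimately show ?thesis
        by (simp add: power2_eq_square algebra_simps)
    qed
    from sum_mono[OF this] show ?thesis
      by (simp add: sum.distrib sum_subtractf sum_distrib_left)
  qed
  ultimately show ?thesis
    unfolding lyapunov_def u_def[symmetric] v_def[symmetric] by linarith
qed

text \<open>
  Since \<open>xs\<close> satisfies the constraints, the subtracted term of the Lyapunov function does not change
  when \<open>x\<close> is replaced by \<open>x - xs\<close>, where \<open>Q\<close> dominates it.
\<close>
lemma lyapunov_lower_bound:
  fixes Q :: "'x::real_inner \<Rightarrow> 'x"
  assumes dom: "\<And>z. (\<Sum>m\<in>M. p m * (a m \<bullet> z)\<^sup>2) + c * (norm z)\<^sup>2 \<le> z \<bullet> Q z"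
    and feas: "\<And>m. m \<in> M \<Longrightarrow> a m \<bullet> xs = 0"
  shows "c * (norm (x - xs))\<^sup>2 + (\<Sum>m\<in>M. (lam m - ls m)\<^sup>2 / p m) \<le> lyapunov Q M a xs ls p x lam"
proof -
  have "(\<Sum>m\<in>M. p m * (a m \<bullet> (x - xs))\<^sup>2) = (\<Sum>m\<in>M. p m * (a m \<bullet> x)\<^sup>2)"
    by (rule sum.cong) (simp_all add: inner_diff_right feas)
  then show ?thesis
    using dom[of "x - xs"] by (simp add: lyapunov_def)
qed

lemma tendsto_0_if_scaled_square_le:
  fixes t g :: "nat \<Rightarrow> real"
  assumes c: "0 < c" and le: "\<And>k. c * (t k)\<^sup>2 \<le> g k" and g: "g \<longlonglongrightarrow> 0"
  shows "t \<longlonglongrightarrow> 0"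
proof -
  have "(\<lambda>k. sqrt (g k / c)) \<longlonglongrightarrow> sqrt (0 / c)"
    using c by (intro tendsto_intros g) simp
  then have "(\<lambda>k. sqrt (g k / c)) \<longlonglongrightarrow> 0"
    by simp
  moreover have "norm (t k) \<le> sqrt (g k / c)" for k
    using le[of k] c by (intro real_le_rsqrt) (simp add: pos_le_divide_eq mult.commute)
  then have "\<forall>\<^sub>F k in sequentially. norm (t k) \<le> sqrt (g k / c)"
    by (simp add: always_eventually)
  ultimately show ?thesis
    by (metis Lim_null_comparison)
qed

text \<open>
  The pair \<open>(xs, ls)\<close> serves only to obtain boundedness and vanishing increments. The limit is
  identified by running the same descent argument with a cluster point of the iterates as the
  reference pair: its Lyapunov function then tends to zero along a subsequence, hence along the
  whole sequence.
\<close>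
theorem primal_dual_convergence:
  fixes G Q :: "'x::euclidean_space \<Rightarrow> 'x" and a :: "'m::finite \<Rightarrow> 'x"
    and x :: "nat \<Rightarrow> 'x" and lam p :: "nat \<Rightarrow> 'm \<Rightarrow> real"
  assumes mono: "\<And>u v. 0 \<le> (G u - G v) \<bullet> (u - v)" and contG: "continuous_on UNIV G"
    and linQ: "linear Q" and symQ: "\<And>u v. u \<bullet> Q v = Q u \<bullet> v"
    and p0: "\<And>m. m \<in> M \<Longrightarrow> 0 < p 0 m"
    and p_incr: "\<And>k m. m \<in> M \<Longrightarrow> p k m \<le> p (Suc k) m"
    and p_bound: "\<And>k m. m \<in> M \<Longrightarrow> p k m \<le> b m"
    and c: "0 < c"
    and dom: "\<And>k z. (\<Sum>m\<in>M. p k m * (a m \<bullet> z)\<^sup>2) + c * (norm z)\<^sup>2 \<le> z \<bullet> Q z"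
    and step: "\<And>k. G (x (Suc k)) + Q (x (Suc k) - x k)
                  + (\<Sum>m\<in>M. (lam k m + p k m * (a m \<bullet> x k)) *\<^sub>R a m) = 0"
    and lam_step: "\<And>k m. m \<in> M \<Longrightarrow> lam (Suc k) m = lam k m + p (Suc k) m * (a m \<bullet> x (Suc k))"
    and KKT: "\<And>m. m \<in> M \<Longrightarrow> a m \<bullet> xs = 0" "G xs + (\<Sum>m\<in>M. ls m *\<^sub>R a m) = 0"
  shows "\<exists>y mu. x \<longlonglongrightarrow> y \<and> (\<forall>m\<in>M. a m \<bullet> y = 0) \<and> G y + (\<Sum>m\<in>M. mu m *\<^sub>R a m) = 0"
proof -
  have p_ge: "p 0 m \<le> p k m" if "m \<in> M" for k m
    by (induction k) (auto intro: order_trans p_incr[OF that])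
  have pos: "0 < p k m" if "m \<in> M" for k m
    using p0[OF that] p_ge[OF that, of k] by linarith
  have p0': "p 0 m \<noteq> 0" if "m \<in> M" for m
    using p0[OF that] by simp
  define V where "V xs ls k = lyapunov Q M a xs ls (p k) (x k) (lam k)" for xs ls k
  have descent: "V xs ls (Suc k) + (\<Sum>m\<in>M. p k m * (a m \<bullet> x (Suc k))\<^sup>2) + c * (norm (x (Suc k) - x k))\<^sup>2 \<le> V xs ls k"
    if "\<And>m. m \<in> M \<Longrightarrow> a m \<bullet> xs = 0" "G xs + (\<Sum>m\<in>M. ls m *\<^sub>R a m) = 0" for xs ls k
    unfolding V_def
    by (rule lyapunov_descent[where G = G]) (rule mono linQ symQ dom step that(2) | rule pos p_incr lam_step that(1), assumption)+
  have lower: "c * (norm (x k - xs))\<^sup>2 + (\<Sum>m\<in>M. (lam k m - ls m)\<^sup>2 / p k m) \<le> V xs ls k"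
    if "\<And>m. m \<in> M \<Longrightarrow> a m \<bullet> xs = 0" for xs ls k
    unfolding V_def by (rule lyapunov_lower_bound) (rule dom | rule that, assumption)+
  have quad_nonneg: "0 \<le> (\<Sum>m\<in>M. p k m * (g m)\<^sup>2)" "0 \<le> (\<Sum>m\<in>M. (g m)\<^sup>2 / p k m)" for k g
    using pos by (auto intro!: sum_nonneg mult_nonneg_nonneg divide_nonneg_nonneg less_imp_le[OF pos])
  have Vdecr: "decseq (V xs ls)"
    if "\<And>m. m \<in> M \<Longrightarrow> a m \<bullet> xs = 0" "G xs + (\<Sum>m\<in>M. ls m *\<^sub>R a m) = 0" for xs ls
  proof (rule decseq_SucI)
    fix k
    have "0 \<le> c * (norm (x (Suc k) - x k))\<^sup>2" using c by simp
    then show "V xs ls (Suc k) \<le> V xs ls k"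
      using descent[OF that, of k] quad_nonneg(1)[of k "\<lambda>m. a m \<bullet> x (Suc k)"] by simp
  qed
  have Vnonneg: "0 \<le> V xs ls k" if "\<And>m. m \<in> M \<Longrightarrow> a m \<bullet> xs = 0" for xs ls k
    by (rule order_trans[OF _ lower[OF that]]) (intro add_nonneg_nonneg quad_nonneg(2), use c in simp)
  obtain L where L: "V xs ls \<longlonglongrightarrow> L"
    by (rule decseq_convergent[OF Vdecr[OF KKT], of 0]) (use Vnonneg[OF KKT(1)] in blast)+
  have gap: "(\<lambda>k. V xs ls k - V xs ls (Suc k)) \<longlonglongrightarrow> 0"
    using tendsto_diff[OF L LIMSEQ_Suc[OF L]] by simp
  have dx: "(\<lambda>k. x (Suc k) - x k) \<longlonglongrightarrow> 0"
  proof -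
    have "c * (norm (x (Suc k) - x k))\<^sup>2 \<le> V xs ls k - V xs ls (Suc k)" for k
      using descent[OF KKT, of k] quad_nonneg(1)[of k "\<lambda>m. a m \<bullet> x (Suc k)"] by linarith
    from tendsto_0_if_scaled_square_le[OF c this gap] show ?thesis
      by (simp add: tendsto_norm_zero_iff)
  qed
  have au: "(\<lambda>k. a m \<bullet> x (Suc k)) \<longlonglongrightarrow> 0" if m: "m \<in> M" for m
  proof (rule tendsto_0_if_scaled_square_le[OF p0[OF m] _ gap])
    fix k
    have "p 0 m * (a m \<bullet> x (Suc k))\<^sup>2 \<le> p k m * (a m \<bullet> x (Suc k))\<^sup>2"
      by (intro mult_right_mono p_ge m) simp
    also have "\<dots> \<le> (\<Sum>m\<in>M. p k m * (a m \<bullet> x (Suc k))\<^sup>2)"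
      by (rule member_le_sum[OF m]) (auto intro!: mult_nonneg_nonneg less_imp_le[OF pos])
    also have "\<dots> \<le> V xs ls k - V xs ls (Suc k)"
    proof -
      have "0 \<le> c * (norm (x (Suc k) - x k))\<^sup>2" using c by simp
      then show ?thesis using descent[OF KKT, of k] by linarith
    qed
    finally show "p 0 m * (a m \<bullet> x (Suc k))\<^sup>2 \<le> V xs ls k - V xs ls (Suc k)" .
  qed
  (* Multipliers with index outside M are unconstrained; they are cut off to get a bounded sequence. *)
  have bnd: "bounded (range (\<lambda>k. (x k, \<chi> m. if m \<in> M then lam k m else 0)))"
  proof -
    have V0: "V xs ls k \<le> V xs ls 0" for k
      using Vdecr[OF KKT] by (simp add: decseq_def)
    have xb: "norm (x k) \<le> norm xs + sqrt (V xs ls 0 / c)" for k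
    proof -
      have "c * (norm (x k - xs))\<^sup>2 \<le> V xs ls 0"
        using lower[OF KKT(1), of k ls] V0[of k] quad_nonneg(2)[where k = k and g = "\<lambda>m. lam k m - ls m"] by linarith
      then have "norm (x k - xs) \<le> sqrt (V xs ls 0 / c)"
        using c by (intro real_le_rsqrt) (simp add: field_simps)
      then show ?thesis using norm_triangle_sub[of "x k" xs] by linarith
    qed
    have lb: "\<bar>lam k m\<bar> \<le> \<bar>ls m\<bar> + sqrt (V xs ls 0 * b m)" if m: "m \<in> M" for k m
    proof -
      have "(lam k m - ls m)\<^sup>2 / p k m \<le> (\<Sum>m\<in>M. (lam k m - ls m)\<^sup>2 / p k m)"
        by (rule member_le_sum[OF m]) (auto intro!: divide_nonneg_nonneg less_imp_le[OF pos])
      also have "\<dots> \<le> c * (norm (x k - xs))\<^sup>2 + \<dots>" using c by simp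
      also have "\<dots> \<le> V xs ls 0"
        using lower[OF KKT(1), of k ls] V0[of k] by linarith
      finally have "(lam k m - ls m)\<^sup>2 \<le> V xs ls 0 * p k m"
        using pos[OF m, of k] by (simp add: field_simps)
      also have "\<dots> \<le> V xs ls 0 * b m"
        by (intro mult_left_mono p_bound m Vnonneg KKT(1))
      finally have "\<bar>lam k m - ls m\<bar> \<le> sqrt (V xs ls 0 * b m)"
        by (intro real_le_rsqrt) simp
      then show ?thesis by linarith
    qed
    show ?thesis
    proof (rule bounded_subset[OF bounded_Times])
      show "bounded (range x)"
        using xb by (auto simp: bounded_iff)
      show "bounded (range (\<lambda>k. (\<chi> m. if m \<in> M then lam k m else 0) :: real^'m))"
      proof (rule boundedI, clarify)
        fix k
        have "norm ((\<chi> m. if m \<in> M then lam k m else 0) :: real^'m)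
            \<le> (\<Sum>m\<in>UNIV. \<bar>((\<chi> m. if m \<in> M then lam k m else 0) :: real^'m) $ m\<bar>)"
          by (rule norm_le_l1_cart)
        also have "\<dots> \<le> (\<Sum>m\<in>UNIV. if m \<in> M then \<bar>ls m\<bar> + sqrt (V xs ls 0 * b m) else 0)"
          by (rule sum_mono) (simp add: lb)
        finally show "norm ((\<chi> m. if m \<in> M then lam k m else 0) :: real^'m)
            \<le> (\<Sum>m\<in>UNIV. if m \<in> M then \<bar>ls m\<bar> + sqrt (V xs ls 0 * b m) else 0)" .
      qed
    qed (intro image_subsetI SigmaI rangeI)
  qed
  obtain w r where r: "strict_mono r"
    and w: "((\<lambda>k. (x k, (\<chi> m. if m \<in> M then lam k m else 0) :: real^'m)) \<circ> r) \<longlonglongrightarrow> w"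
    using bounded_imp_convergent_subsequence[OF bnd] by auto
  define y mu where "y = fst w" and "mu m = snd w $ m" for m
  have xr: "(\<lambda>k. x (r k)) \<longlonglongrightarrow> y"
    using tendsto_fst[OF w] by (simp add: y_def comp_def)
  have lr: "(\<lambda>k. lam (r k) m) \<longlonglongrightarrow> mu m" if "m \<in> M" for m
    using tendsto_vec_nth[OF tendsto_snd[OF w], of m] that by (simp add: mu_def comp_def)
  have ax: "(\<lambda>k. a m \<bullet> x k) \<longlonglongrightarrow> 0" if "m \<in> M" for m
    using au[OF that] by (rule LIMSEQ_imp_Suc)
  have pax: "(\<lambda>k. p k m * (a m \<bullet> x k)) \<longlonglongrightarrow> 0" if m: "m \<in> M" for m
  proof (rule Lim_null_comparison[OF always_eventually])
    show "\<forall>k. norm (p k m * (a m \<bullet> x k)) \<le> b m * \<bar>a m \<bullet> x k\<bar>"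
      using p_bound[OF m] by (simp add: abs_mult abs_of_pos[OF pos[OF m]] mult_right_mono)
    show "(\<lambda>k. b m * \<bar>a m \<bullet> x k\<bar>) \<longlonglongrightarrow> 0"
      using tendsto_mult_right_zero[OF tendsto_rabs_zero[OF ax[OF m]]] by simp
  qed
  have dxr: "(\<lambda>k. x (Suc (r k)) - x (r k)) \<longlonglongrightarrow> 0"
    using LIMSEQ_subseq_LIMSEQ[OF dx r] by (simp add: comp_def)
  have xSr: "(\<lambda>k. x (Suc (r k))) \<longlonglongrightarrow> y"
    using tendsto_add[OF dxr xr] by simp
  have feas: "a m \<bullet> y = 0" if "m \<in> M" for m
  proof -
    have "(\<lambda>k. a m \<bullet> x (r k)) \<longlonglongrightarrow> a m \<bullet> y" by (intro tendsto_intros xr)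
    moreover have "(\<lambda>k. a m \<bullet> x (r k)) \<longlonglongrightarrow> 0"
      using LIMSEQ_subseq_LIMSEQ[OF ax[OF that] r] by (simp add: comp_def)
    ultimately show ?thesis by (rule LIMSEQ_unique)
  qed
  have stat: "G y + (\<Sum>m\<in>M. mu m *\<^sub>R a m) = 0"
  proof -
    have lim_Q: "(\<lambda>k. Q (x (Suc (r k)) - x (r k))) \<longlonglongrightarrow> Q 0"
      using linQ by (intro bounded_linear.tendsto[OF _ dxr]) (simp add: linear_conv_bounded_linear)
    have lim_G: "(\<lambda>k. G (x (Suc (r k)))) \<longlonglongrightarrow> G y"
      by (rule continuous_on_tendsto_compose[OF contG xSr]) auto
    have lim_p: "(\<lambda>k. p (r k) m * (a m \<bullet> x (r k))) \<longlonglongrightarrow> 0" if "m \<in> M" for m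
      using LIMSEQ_subseq_LIMSEQ[OF pax[OF that] r] by (simp add: comp_def)
    have "(\<lambda>k. G (x (Suc (r k))) + Q (x (Suc (r k)) - x (r k))
                  + (\<Sum>m\<in>M. (lam (r k) m + p (r k) m * (a m \<bullet> x (r k))) *\<^sub>R a m))
        \<longlonglongrightarrow> G y + Q 0 + (\<Sum>m\<in>M. (mu m + 0) *\<^sub>R a m)"
      by (intro tendsto_add tendsto_sum tendsto_scaleR tendsto_const lim_Q lim_G lim_p lr)
    then show ?thesis
      using linear_0[OF linQ] by (simp add: step LIMSEQ_const_iff)
  qed
  (* Along r the Lyapunov function is squeezed to zero; the fixed weights p 0 give an upper bound
     independent of the moving ones. *)
  have V0: "V y mu \<longlonglongrightarrow> 0"
  proof -
    obtain L' where L': "V y mu \<longlonglongrightarrow> L'"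
      by (rule decseq_convergent[OF Vdecr[OF feas stat], of 0]) (use Vnonneg[OF feas] in blast)+
    have upper: "V y mu (r k) \<le> (x (r k) - y) \<bullet> Q (x (r k) - y) + (\<Sum>m\<in>M. (lam (r k) m - mu m)\<^sup>2 / p 0 m)" for k
    proof -
      have "(\<Sum>m\<in>M. (lam (r k) m - mu m)\<^sup>2 / p (r k) m) \<le> (\<Sum>m\<in>M. (lam (r k) m - mu m)\<^sup>2 / p 0 m)"
        by (rule sum_mono) (auto intro!: divide_left_mono p_ge mult_pos_pos pos)
      then show ?thesis
        using quad_nonneg(1)[of "r k" "\<lambda>m. a m \<bullet> x (r k)"] by (simp add: V_def lyapunov_def)
    qed
    have xy: "(\<lambda>k. x (r k) - y) \<longlonglongrightarrow> 0" using xr by (simp add: LIM_zero)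
    have Qxy: "(\<lambda>k. Q (x (r k) - y)) \<longlonglongrightarrow> Q 0"
      using linQ by (intro bounded_linear.tendsto[OF _ xy]) (simp add: linear_conv_bounded_linear)
    have "(\<lambda>k. (x (r k) - y) \<bullet> Q (x (r k) - y) + (\<Sum>m\<in>M. (lam (r k) m - mu m)\<^sup>2 / p 0 m))
        \<longlonglongrightarrow> 0 \<bullet> Q 0 + (\<Sum>m\<in>M. (mu m - mu m)\<^sup>2 / p 0 m)"
      by (intro tendsto_intros lr xy Qxy p0')
    then have "L' \<le> 0"
      using LIMSEQ_le[OF LIMSEQ_subseq_LIMSEQ[OF L' r]] upper by (auto simp: comp_def)
    moreover have "0 \<le> L'"
      using LIMSEQ_le_const[OF L'] Vnonneg[OF feas] by blast
    ultimately show ?thesis using L' by simp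
  qed
  have "c * (norm (x k - y))\<^sup>2 \<le> V y mu k" for k
    using lower[OF feas, of k mu] quad_nonneg(2)[where k = k and g = "\<lambda>m. lam k m - mu m"] by linarith
  from tendsto_0_if_scaled_square_le[OF c this V0] have "x \<longlonglongrightarrow> y"
    by (simp add: tendsto_norm_zero_iff LIM_zero_iff)
  with feas stat show ?thesis by blast
qed

section \<open>Gradients of convex functions and coercivity\<close>

lemma gradient_zero_at_minimum:
  fixes g :: "'a::real_inner \<Rightarrow> real"
  assumes "GDERIV g x :> D" and "\<And>y. g x \<le> g y"
  shows "D = 0"
proof -
  have "(\<lambda>h. h \<bullet> D) = (\<lambda>h. 0)"
    using assms by (intro differential_zero_maxmin[of x UNIV g]) (auto simp: gderiv_def)
  then have "D \<bullet> D = 0" by meson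
  then show ?thesis by simp
qed

text \<open>The one-dimensional tangent inequality, applied on the line from \<open>x\<close> to \<open>y\<close>.\<close>
lemma convex_on_imp_above_tangent_plane:
  fixes g :: "'a::real_inner \<Rightarrow> real"
  assumes conv: "convex_on UNIV g" and D: "GDERIV g x :> D"
  shows "g x + D \<bullet> (y - x) \<le> g y"
proof -
  define h where "h t = g (x + t *\<^sub>R (y - x))" for t :: real
  have "convex_on UNIV h"
  proof (rule convex_onI)
    fix t r s :: real assume t: "0 < t" "t < 1"
    have "x + ((1 - t) *\<^sub>R r + t *\<^sub>R s) *\<^sub>R (y - x)
        = (1 - t) *\<^sub>R (x + r *\<^sub>R (y - x)) + t *\<^sub>R (x + s *\<^sub>R (y - x))"
      by (simp add: algebra_simps)
    then show "h ((1 - t) *\<^sub>R r + t *\<^sub>R s) \<le> (1 - t) * h r + t * h s"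
      unfolding h_def using convex_onD[OF conv, of t] t by simp
  qed simp
  moreover have "(h has_field_derivative (D \<bullet> (y - x))) (at 0)"
  proof -
    have "((\<lambda>t. x + t *\<^sub>R (y - x)) has_derivative (\<lambda>t. t *\<^sub>R (y - x))) (at 0)"
      by (auto intro!: derivative_eq_intros)
    moreover have "(g has_derivative (\<lambda>h. h \<bullet> D)) (at (x + 0 *\<^sub>R (y - x)))"
      using D by (simp add: gderiv_def)
    ultimately have "(h has_derivative (\<lambda>t. (t *\<^sub>R (y - x)) \<bullet> D)) (at 0)"
      unfolding h_def by (rule has_derivative_compose)
    moreover have "(\<lambda>t. (t *\<^sub>R (y - x)) \<bullet> D) = (*) (D \<bullet> (y - x))"
      by (auto simp: fun_eq_iff inner_commute)
    ultimately show ?thesis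
      by (simp add: has_field_derivative_def)
  qed
  ultimately have "(D \<bullet> (y - x)) * (1 - 0) \<le> h 1 - h 0"
    by (intro convex_on_imp_above_tangent[of UNIV]) auto
  then show ?thesis
    by (simp add: h_def)
qed

text \<open>The constant is the minimum of the quadratic form on the unit sphere.\<close>
lemma pos_def_imp_coercive:
  fixes D :: "real^'a::finite^'a"
  assumes "\<And>v. v \<noteq> 0 \<Longrightarrow> 0 < v \<bullet> (D *v v)"
  obtains c where "0 < c" "\<And>v. c * (norm v)\<^sup>2 \<le> v \<bullet> (D *v v)"
proof -
  have "axis undefined 1 \<in> sphere (0 :: real^'a) 1" by simp
  then have ne: "sphere (0 :: real^'a) 1 \<noteq> {}" by blast
  have "continuous_on (sphere 0 1) (\<lambda>v. v \<bullet> (D *v v))"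
    by (intro continuous_intros linear_continuous_on) simp
  then obtain u where u: "u \<in> sphere 0 1" "\<And>v. v \<in> sphere 0 1 \<Longrightarrow> u \<bullet> (D *v u) \<le> v \<bullet> (D *v v)"
    using continuous_attains_inf[OF compact_sphere ne] by blast
  show thesis
  proof (rule that[of "u \<bullet> (D *v u)"])
    have "u \<noteq> 0" using u(1) by auto
    then show "0 < u \<bullet> (D *v u)" by (rule assms)
    fix v
    show "(u \<bullet> (D *v u)) * (norm v)\<^sup>2 \<le> v \<bullet> (D *v v)"
    proof (cases "v = 0")
      case False
      define s where "s = inverse (norm v) *\<^sub>R v"
      have v: "v = norm v *\<^sub>R s" using False by (simp add: s_def)
      have "u \<bullet> (D *v u) \<le> s \<bullet> (D *v s)"
        using False by (intro u(2)) (simp add: s_def)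
      then have "(u \<bullet> (D *v u)) * (norm v)\<^sup>2 \<le> (s \<bullet> (D *v s)) * (norm v)\<^sup>2"
        by (rule mult_right_mono) simp
      also have "\<dots> = (norm v *\<^sub>R s) \<bullet> (D *v (norm v *\<^sub>R s))"
        by (simp add: matrix_vector_mult_scaleR power2_eq_square)
      finally show ?thesis using v by simp
    qed simp
  qed
qed

section \<open>The objective and its gradient\<close>

definition stacked_gradient ::
  "('n \<Rightarrow> real^'d \<Rightarrow> real^'d) \<Rightarrow> real^('n::finite \<times> 'd::finite) \<Rightarrow> real^('n \<times> 'd)" where
  "stacked_gradient g z = (\<chi> q. g (fst q) (block z (fst q)) $ snd q)"

lemma block_stacked_gradient [simp]: "block (stacked_gradient g z) i = g i (block z i)"
  by (simp add: stacked_gradient_def block_def vec_eq_iff)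

lemma block_nth [simp]: "block z i $ d = z $ (i, d)"
  by (simp add: block_def)

lemma block_diff: "block (u - v) i = block u i - block v i"
  by (simp add: vec_eq_iff)

lemma bounded_linear_block: "bounded_linear (\<lambda>z. block z i)"
  by (rule linear_conv_bounded_linear[THEN iffD1], rule linearI) (simp_all add: vec_eq_iff)

lemma inner_block: "u \<bullet> v = (\<Sum>i\<in>UNIV. block u i \<bullet> block v i)"
  by (simp add: inner_vec_def sum.cartesian_product flip: UNIV_Times_UNIV)

lemma objective_gradient:
  assumes "\<And>i z. GDERIV (f i) z :> g i z"
  shows "GDERIV (objective f) z :> stacked_gradient g z"
proof -
  have "((\<lambda>z. f i (block z i)) has_derivative (\<lambda>h. block h i \<bullet> g i (block z i))) (at z)" for i
    using bounded_linear_imp_has_derivative[OF bounded_linear_block] assms[of i "block z i"]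
    unfolding gderiv_def by (rule has_derivative_compose)
  then have "(objective f has_derivative (\<lambda>h. \<Sum>i\<in>UNIV. block h i \<bullet> g i (block z i))) (at z)"
    unfolding objective_def by (intro has_derivative_sum)
  then show ?thesis
    by (simp add: gderiv_def inner_block)
qed

lemma objective_above_tangent:
  assumes "\<And>i. convex_on UNIV (f i)" and "\<And>i z. GDERIV (f i) z :> g i z"
  shows "objective f u + stacked_gradient g u \<bullet> (v - u) \<le> objective f v"
proof -
  have "(\<Sum>i\<in>UNIV. f i (block u i) + g i (block u i) \<bullet> (block v i - block u i)) \<le> (\<Sum>i\<in>UNIV. f i (block v i))"
    by (intro sum_mono convex_on_imp_above_tangent_plane assms)
  then show ?thesis
    by (simp add: objective_def inner_block block_diff sum.distrib)
qed

text \<open>Add the tangent inequality at \<open>u\<close> to the one at \<open>v\<close>.\<close>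
lemma stacked_gradient_monotone:
  assumes "\<And>i. convex_on UNIV (f i)" and "\<And>i z. GDERIV (f i) z :> g i z"
  shows "0 \<le> (stacked_gradient g u - stacked_gradient g v) \<bullet> (u - v)"
  using objective_above_tangent[where f = f and g = g and u = u and v = v, OF assms]
    objective_above_tangent[where f = f and g = g and u = v and v = u, OF assms]
  by (simp add: inner_diff_left inner_diff_right)

lemma continuous_stacked_gradient:
  assumes "\<And>i. continuous_on UNIV (g i)"
  shows "continuous_on UNIV (stacked_gradient g)"
  unfolding stacked_gradient_def
proof (intro continuous_on_vec_lambda continuous_on_component)
  fix q :: "'a \<times> 'b"
  show "continuous_on UNIV (\<lambda>z. g (fst q) (block z (fst q)))"
    using continuous_on_compose2[OF assms] linear_continuous_on[OF bounded_linear_block]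
    by (metis subset_UNIV)
qed

section \<open>Incidence and penalty matrices\<close>

lemma kronecker_diag_mult:
  "kronecker (diag w) (mat 1) *v v = (\<chi> q. w (fst q) * v $ q)"
proof -
  have "(\<Sum>q\<in>UNIV. kronecker (diag w) (mat 1) $ r $ q * v $ q) = w (fst r) * v $ r" for r
  proof -
    have "kronecker (diag w) (mat 1) $ r $ q * v $ q = (if r = q then w (fst r) * v $ r else 0)" for q
      by (cases q, cases r) (simp add: kronecker_def diag_def mat_def)
    then show ?thesis by simp
  qed
  then show ?thesis
    by (simp add: vec_eq_iff matrix_vector_mult_def)
qed

lemma penalty_quadratic_form:
  "v \<bullet> (penalty_mat E r *v v) = (\<Sum>m\<in>E \<times> UNIV. r (fst (fst m)) (snd (fst m)) * (v $ m)\<^sup>2)"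
proof -
  have "v \<bullet> (penalty_mat E r *v v)
      = (\<Sum>m\<in>UNIV. if m \<in> E \<times> UNIV then r (fst (fst m)) (snd (fst m)) * (v $ m)\<^sup>2 else 0)"
    unfolding penalty_mat_def kronecker_diag_mult inner_vec_def
    by (rule sum.cong) (auto simp: power2_eq_square)
  then show ?thesis
    by (simp flip: sum.inter_restrict)
qed

lemma incidence_row:
  assumes "fst e \<noteq> snd e"
  shows "incidence E $ (e, d) \<bullet> z = (if e \<in> E then z $ (fst e, d) - z $ (snd e, d) else 0)"
proof -
  have "incidence E $ (e, d) \<bullet> z
      = (\<Sum>q\<in>UNIV. (if q = (fst e, d) then if e \<in> E then z $ q else 0 else 0)
                  - (if q = (snd e, d) then if e \<in> E then z $ q else 0 else 0))"
    unfolding inner_vec_def using assms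
    by (intro sum.cong) (auto simp: incidence_def kronecker_def mat_def prod_eq_iff)
  then show ?thesis
    by (simp add: sum_subtractf)
qed

lemma incidence_mult_nth: "(incidence E *v z) $ m = incidence E $ m \<bullet> z"
  by (rule matrix_vector_mul_component)

lemma incidence_row_outside: "m \<notin> E \<times> UNIV \<Longrightarrow> incidence E $ m = 0"
  by (cases m) (auto simp: incidence_def kronecker_def vec_eq_iff)

lemma incidence_mult_edge_vecs: "incidence E *v z \<in> edge_vecs E"
  by (auto simp: edge_vecs_def incidence_mult_nth incidence_row_outside)

lemma feasible_iff: "incidence E *v z = 0 \<longleftrightarrow> (\<forall>m\<in>E \<times> UNIV. incidence E $ m \<bullet> z = 0)"
  unfolding vec_eq_iff incidence_mult_nth using incidence_row_outside
  by (metis inner_zero_left zero_index)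

text \<open>
  Row \<open>((s, t), d)\<close> of the incidence matrix meets agent \<open>i\<close> with sign \<open>+\<close> if \<open>s = i\<close> and \<open>-\<close> if
  \<open>t = i\<close>. For an edge quantity that changes sign under reversal, both cases contribute \<open>h i j\<close>, so
  that the sum over oriented edges becomes the sum over the neighbours that the agent itself sees.
\<close>
lemma transpose_incidence_nth:
  fixes w :: "('n::{finite,linorder} \<times> 'n) \<times> 'd::finite \<Rightarrow> real"
  assumes E: "\<And>i j. (i, j) \<in> E \<Longrightarrow> i < j"
    and antisym: "\<And>i j. (i, j) \<in> E \<Longrightarrow> h j i = - h i j"
    and w: "\<And>i j. (i, j) \<in> E \<Longrightarrow> w ((i, j), d) = h i j"
  shows "(\<Sum>m\<in>E \<times> UNIV. w m *\<^sub>R incidence E $ m) $ (i, d) = (\<Sum>j\<in>nbrs E i - {i}. h i j)"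
proof -
  have fin: "finite E" by simp
  have "(\<Sum>m\<in>E \<times> UNIV. w m *\<^sub>R incidence E $ m) $ (i, d)
      = (\<Sum>e\<in>E. \<Sum>d'\<in>UNIV. w (e, d') * incidence E $ (e, d') $ (i, d))"
    by (simp add: sum.cartesian_product split_def)
  also have "\<dots> = (\<Sum>e\<in>E. (if fst e = i then h (fst e) (snd e) else 0) + (if snd e = i then h (snd e) (fst e) else 0))"
  proof (rule sum.cong)
    fix e assume e: "e \<in> E"
    then have "fst e < snd e" using E by (metis prod.collapse)
    then have "w (e, d') * incidence E $ (e, d') $ (i, d)
      = (if d' = d then (if fst e = i then h (fst e) (snd e) else 0) + (if snd e = i then h (snd e) (fst e) else 0) else 0)" for d'
      using e w[of "fst e" "snd e"] antisym[of "fst e" "snd e"]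
      by (auto simp: incidence_def kronecker_def mat_def)
    then show "(\<Sum>d'\<in>UNIV. w (e, d') * incidence E $ (e, d') $ (i, d))
      = (if fst e = i then h (fst e) (snd e) else 0) + (if snd e = i then h (snd e) (fst e) else 0)"
      by simp
  qed simp
  also have "\<dots> = (\<Sum>e\<in>{e\<in>E. fst e = i}. h (fst e) (snd e)) + (\<Sum>e\<in>{e\<in>E. snd e = i}. h (snd e) (fst e))"
    by (simp only: sum.distrib sum.inter_filter[OF fin])
  also have "(\<Sum>e\<in>{e\<in>E. fst e = i}. h (fst e) (snd e)) = (\<Sum>j\<in>{j. (i, j) \<in> E}. h i j)"
    by (rule sum.reindex_bij_witness[of _ "\<lambda>j. (i, j)" snd]) auto
  also have "(\<Sum>e\<in>{e\<in>E. snd e = i}. h (snd e) (fst e)) = (\<Sum>j\<in>{j. (j, i) \<in> E}. h i j)"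
    by (rule sum.reindex_bij_witness[of _ "\<lambda>j. (j, i)" fst]) auto
  also have "(\<Sum>j\<in>{j. (i, j) \<in> E}. h i j) + (\<Sum>j\<in>{j. (j, i) \<in> E}. h i j)
      = (\<Sum>j\<in>{j. (i, j) \<in> E} \<union> {j. (j, i) \<in> E}. h i j)"
    by (rule sum.union_disjoint[symmetric]) (use E less_asym in \<open>simp, simp, blast\<close>)
  also have "{j. (i, j) \<in> E} \<union> {j. (j, i) \<in> E} = nbrs E i - {i}"
    using E by (auto simp: nbrs_def)
  finally show ?thesis .
qed

text \<open>Test the order on a coordinate vector; it lies in the edge space because \<open>m\<close> belongs to an edge.\<close>
lemma loewner_le_diagonal:
  assumes "loewner_le (edge_vecs E) P P'" and "fst m \<in> E"
  shows "P $ m $ m \<le> P' $ m $ m"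
proof -
  have "axis m 1 \<in> edge_vecs E"
    using assms(2) by (auto simp: edge_vecs_def axis_def)
  then have "0 \<le> axis m 1 \<bullet> ((P' - P) *v axis m 1)"
    using assms(1) unfolding loewner_le_def by blast
  then show ?thesis
    by (simp add: inner_axis' matrix_vector_mult_basis column_def)
qed

lemma penalty_mat_diagonal: "fst m \<in> E \<Longrightarrow> penalty_mat E r $ m $ m = r (fst (fst m)) (snd (fst m))"
  by (simp add: penalty_mat_def kronecker_def diag_def mat_def)

section \<open>Saddle points, KKT pairs and optimal solutions\<close>

text \<open>
  If the residual \<open>A xs\<close> were nonzero, moving the multiplier in its direction would increase the
  Lagrangian; so \<open>xs\<close> is feasible. Stationarity is the vanishing gradient at the minimum over \<open>z\<close>.
\<close>
lemma saddle_point_imp_KKT: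
  fixes E :: "('n::{finite,linorder} \<times> 'n) set" and ls :: "real^(('n \<times> 'n) \<times> 'd::finite)"
  assumes grad: "\<And>i z. GDERIV (f i) z :> g i z" and saddle: "saddle_point E f xs ls"
  shows "\<And>m. m \<in> E \<times> UNIV \<Longrightarrow> incidence E $ m \<bullet> xs = 0"
    and "stacked_gradient g xs + (\<Sum>m\<in>E \<times> UNIV. ls $ m *\<^sub>R incidence E $ m) = 0"
proof -
  have ls: "ls \<in> edge_vecs E"
    and max: "\<And>l. l \<in> edge_vecs E \<Longrightarrow> lagrangian E f xs l \<le> lagrangian E f xs ls"
    and min: "\<And>z. lagrangian E f xs ls \<le> lagrangian E f z ls"
    using saddle unfolding saddle_point_def by blast+
  let ?r = "incidence E *v xs"
  have "ls + ?r \<in> edge_vecs E"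
    using ls incidence_mult_edge_vecs[of E xs] by (simp add: edge_vecs_def)
  from max[OF this] have "?r \<bullet> ?r \<le> 0"
    by (simp add: lagrangian_def inner_add_left)
  then have "?r = 0" by (metis inner_eq_zero_iff inner_ge_zero order_antisym)
  then show "incidence E $ m \<bullet> xs = 0" if "m \<in> E \<times> UNIV" for m
    using that feasible_iff by blast
  let ?S = "\<Sum>m\<in>E \<times> UNIV. ls $ m *\<^sub>R incidence E $ m"
  have "ls \<bullet> (incidence E *v z) = z \<bullet> ?S" for z
  proof -
    have "ls \<bullet> (incidence E *v z) = (\<Sum>m\<in>UNIV. ls $ m * (incidence E $ m \<bullet> z))"
      by (simp add: inner_vec_def[of ls] incidence_mult_nth)
    also have "\<dots> = (\<Sum>m\<in>E \<times> UNIV. ls $ m * (incidence E $ m \<bullet> z))"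
      by (rule sum.mono_neutral_right) (auto simp: incidence_row_outside)
    finally show ?thesis
      by (simp add: inner_sum_right inner_commute)
  qed
  then have "lagrangian E f z ls = objective f z + z \<bullet> ?S" for z
    by (simp add: lagrangian_def)
  moreover have "GDERIV (\<lambda>z. z \<bullet> ?S) xs :> ?S"
    unfolding gderiv_def by (rule bounded_linear_imp_has_derivative[OF bounded_linear_inner_left])
  ultimately have "GDERIV (\<lambda>z. lagrangian E f z ls) xs :> stacked_gradient g xs + ?S"
    using GDERIV_add[OF objective_gradient[OF grad]] by simp
  then show "stacked_gradient g xs + ?S = 0"
    by (rule gradient_zero_at_minimum) (rule min)
qed

text \<open>
  The gradient at \<open>y\<close> is a combination of constraint rows, hence orthogonal to every feasible
  displacement, and the tangent inequality does the rest.
\<close>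
lemma KKT_imp_optimal_solution:
  fixes E :: "('n::{finite,linorder} \<times> 'n) set" and mu :: "('n \<times> 'n) \<times> 'd::finite \<Rightarrow> real"
  assumes conv: "\<And>i. convex_on UNIV (f i)" and grad: "\<And>i z. GDERIV (f i) z :> g i z"
    and feas: "\<And>m. m \<in> E \<times> UNIV \<Longrightarrow> incidence E $ m \<bullet> y = 0"
    and stat: "stacked_gradient g y + (\<Sum>m\<in>E \<times> UNIV. mu m *\<^sub>R incidence E $ m) = 0"
  shows "optimal_solution E f y"
proof -
  have "objective f y \<le> objective f z" if "incidence E *v z = 0" for z
  proof -
    have z: "incidence E $ m \<bullet> (z - y) = 0" if "m \<in> E \<times> UNIV" for m
      using feas[OF that] \<open>incidence E *v z = 0\<close> that unfolding feasible_iff inner_diff_right by (metis diff_self)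
    have "stacked_gradient g y = - (\<Sum>m\<in>E \<times> UNIV. mu m *\<^sub>R incidence E $ m)"
      using stat by (simp add: eq_neg_iff_add_eq_0)
    then have "stacked_gradient g y \<bullet> (z - y) = 0"
      using z by (simp add: inner_sum_left)
    then show ?thesis
      using objective_above_tangent[where f = f and g = g and u = y and v = z, OF conv grad] by simp
  qed
  moreover have "incidence E *v y = 0"
    using feas feasible_iff by blast
  ultimately show ?thesis
    by (auto simp: optimal_solution_def is_arg_min_def not_less)
qed

section \<open>Convergence of the algorithm\<close>

lemma penalty_row_sum:
  "admissible_penalties E r \<Longrightarrow> (\<Sum>j\<in>nbrs E i. r i j) = 1"
  for E :: "('n::{finite,linorder} \<times> 'n) set"
  using sum.remove[of "nbrs E i" i "r i"] by (simp add: nbrs_def admissible_penalties_def)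

text \<open>
  The minimiser \<open>z\<close> enters all penalty terms \<open>r i j (z - x j)\<close>. Splitting each as
  \<open>r i j (z - x i) + r i j (x i - x j)\<close> and using that the weights sum to one turns them into a
  single proximal term \<open>z - x i\<close> and a part that depends on the old iterate alone; this is where the
  weight \<open>\<gamma> i + 1\<close> comes from.
\<close>
lemma agent_step_stationarity:
  fixes E :: "('n::{finite,linorder} \<times> 'n) set"
  assumes grad: "\<And>z. GDERIV (f i) z :> g z"
    and pen: "admissible_penalties E r" and l0: "l i i = 0"
    and min: "is_arg_min (local_objective E f \<gamma> x l r i) (\<lambda>_. True) z"
  shows "g z + (\<gamma> i + 1) *\<^sub>R (z - block x i)
     + (\<Sum>j\<in>nbrs E i - {i}. l i j + r i j *\<^sub>R (block x i - block x j)) = 0"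
proof -
  have rowsum: "(\<Sum>j\<in>nbrs E i. r i j) = 1"
    by (rule penalty_row_sum[OF pen])
  have sq: "GDERIV (\<lambda>z. s / 2 * (norm (z - y))\<^sup>2) z :> s *\<^sub>R (z - y)" for s :: real and y
    unfolding gderiv_def power2_norm_eq_inner
    by (auto intro!: derivative_eq_intros simp: inner_commute algebra_simps)
  have lin: "GDERIV (\<lambda>z. v \<bullet> z) z :> v" for v
    unfolding gderiv_def inner_commute[of v]
    by (rule bounded_linear_imp_has_derivative[OF bounded_linear_inner_left])
  have "GDERIV (\<lambda>z. \<Sum>j\<in>nbrs E i. l i j \<bullet> z + r i j / 2 * (norm (z - block x j))\<^sup>2) z
      :> (\<Sum>j\<in>nbrs E i. l i j + r i j *\<^sub>R (z - block x j))"
    unfolding gderiv_def inner_sum_right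
    by (intro has_derivative_sum) (use GDERIV_add[OF lin sq] in \<open>simp add: gderiv_def\<close>)
  then have "GDERIV (local_objective E f \<gamma> x l r i) z
      :> g z + \<gamma> i *\<^sub>R (z - block x i) + (\<Sum>j\<in>nbrs E i. l i j + r i j *\<^sub>R (z - block x j))"
    unfolding local_objective_def by (intro GDERIV_add grad sq)
  then have "g z + \<gamma> i *\<^sub>R (z - block x i) + (\<Sum>j\<in>nbrs E i. l i j + r i j *\<^sub>R (z - block x j)) = 0"
    by (rule gradient_zero_at_minimum) (use min in \<open>simp add: is_arg_min_def not_less\<close>)
  moreover have "(\<Sum>j\<in>nbrs E i. l i j + r i j *\<^sub>R (z - block x j))
      = (z - block x i) + (\<Sum>j\<in>nbrs E i - {i}. l i j + r i j *\<^sub>R (block x i - block x j))"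
  proof -
    have "(\<Sum>j\<in>nbrs E i. l i j + r i j *\<^sub>R (z - block x j))
        = (\<Sum>j\<in>nbrs E i. r i j) *\<^sub>R (z - block x i)
          + (\<Sum>j\<in>nbrs E i. l i j + r i j *\<^sub>R (block x i - block x j))"
      unfolding scaleR_sum_left sum.distrib[symmetric]
      by (rule sum.cong) (simp_all add: algebra_simps)
    also have "(\<Sum>j\<in>nbrs E i. l i j + r i j *\<^sub>R (block x i - block x j))
        = (\<Sum>j\<in>nbrs E i - {i}. l i j + r i j *\<^sub>R (block x i - block x j))"
      by (subst sum.remove[of _ i]) (simp_all add: nbrs_def l0)
    finally show ?thesis by (simp add: rowsum)
  qed
  ultimately show ?thesis
    by (simp add: scaleR_add_left add.assoc)
qed

text \<open>
  The algorithm is an instance of the abstract iteration: \<open>M = E \<times> UNIV\<close> indexes the rows of the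
  incidence matrix, \<open>Q\<close> multiplies the block of agent \<open>i\<close> by \<open>\<gamma> i + 1\<close>, and the diagonal of \<open>R\<close>
  bounds the penalties.
\<close>
theorem theorem1:
  fixes E :: "('n::{finite,linorder} \<times> 'n) set"
    and f :: "'n \<Rightarrow> real^'d \<Rightarrow> real"
    and \<gamma> :: "'n \<Rightarrow> real"
    and x :: "nat \<Rightarrow> real^('n \<times> 'd)"
    and l :: "nat \<Rightarrow> 'n \<Rightarrow> 'n \<Rightarrow> real^'d"
    and \<rho> :: "nat \<Rightarrow> 'n \<Rightarrow> 'n \<Rightarrow> real"
    and R :: "real^(('n \<times> 'n) \<times> 'd)^(('n \<times> 'n) \<times> 'd)"
  assumes "connected_graph E"
    and "\<And>i. convex_on UNIV (f i)"
    and "\<And>i. continuously_differentiable (f i)"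
    and "\<exists>xs ls. saddle_point E f xs ls"
    and "\<And>i. 0 < \<gamma> i"
    and "algorithm_I E f \<gamma> x l \<rho>"
    and "R \<in> edge_mats E" and "transpose R = R"
    and "loewner_less (edge_vecs E) 0 (penalty_mat E (\<rho> 0))"
    and "\<And>k. loewner_le (edge_vecs E) (penalty_mat E (\<rho> 0)) (penalty_mat E (\<rho> k))"
    and "\<And>k. loewner_le (edge_vecs E) (penalty_mat E (\<rho> k)) (penalty_mat E (\<rho> (Suc k)))"
    and "\<And>k. loewner_le (edge_vecs E) (penalty_mat E (\<rho> (Suc k))) R"
    and "\<And>k. loewner_less UNIV (transpose (incidence E) ** R ** incidence E)
               (Q_P \<gamma> + Q_C E (\<rho> k))"
  shows "\<exists>xs. optimal_solution E f xs \<and> x \<longlonglongrightarrow> xs"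
proof -
  have orient: "i < j" if "(i, j) \<in> E" for i j
    using assms(1) that by (auto simp: connected_graph_def)
  have "\<forall>i. \<exists>g'. (\<forall>z. GDERIV (f i) z :> g' z) \<and> continuous_on UNIV g'"
    using assms(3) by (simp add: continuously_differentiable_def)
  then obtain g where grad: "\<And>i z. GDERIV (f i) z :> g i z" and contg: "\<And>i. continuous_on UNIV (g i)"
    by metis
  obtain xs and ls :: "real^(('n \<times> 'n) \<times> 'd)" where saddle: "saddle_point E f xs ls"
    using assms(4) by blast
  have pen: "admissible_penalties E (\<rho> k)"
    and l_antisym: "(i, j) \<in> E \<Longrightarrow> l k j i = - l k i j"
    and l_diag: "l k i i = 0"
    and min: "is_arg_min (local_objective E f \<gamma> (x k) (l k) (\<rho> k) i) (\<lambda>_. True) (block (x (Suc k)) i)"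
    and l_step: "j \<in> nbrs E i \<Longrightarrow> l (Suc k) i j =
        l k i j + \<rho> (Suc k) i j *\<^sub>R (block (x (Suc k)) i - block (x (Suc k)) j)" for k i j
    using assms(6) unfolding algorithm_I_def by blast+
  have \<rho>_sym: "\<rho> k j i = \<rho> k i j" and \<rho>_pos: "0 < \<rho> k i j" if "(i, j) \<in> E" for k i j
    using pen[of k] that by (auto simp: admissible_penalties_def)
  define Q :: "real^('n \<times> 'd) \<Rightarrow> real^('n \<times> 'd)" where "Q z = (\<chi> q. (\<gamma> (fst q) + 1) * z $ q)" for z
  have Q_eq: "(Q_P \<gamma> + Q_C E (\<rho> k)) *v z = Q z" for k z
    by (simp add: matrix_vector_mult_add_rdistrib Q_P_def Q_C_def kronecker_diag_mult Q_def
        penalty_row_sum[OF pen] vec_eq_iff algebra_simps)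
  (* The difference matrix is the same for every k because all rows of penalties sum to one. *)
  obtain c where c: "0 < c"
    and coercive: "\<And>z :: real^('n \<times> 'd). c * (norm z)\<^sup>2
      \<le> z \<bullet> ((Q_P \<gamma> + Q_C E (\<rho> 0) - transpose (incidence E) ** R ** incidence E) *v z)"
    using pos_def_imp_coercive assms(13)[of 0] unfolding loewner_less_def by blast
  define p where "p k m = \<rho> k (fst (fst m)) (snd (fst m))" for k and m :: "('n \<times> 'n) \<times> 'd"
  define lam where "lam k m = l k (fst (fst m)) (snd (fst m)) $ snd m" for k and m :: "('n \<times> 'n) \<times> 'd"
  have edge: "fst m \<in> E" "(fst (fst m), snd (fst m)) \<in> E" if "m \<in> E \<times> UNIV" for m :: "('n \<times> 'n) \<times> 'd"
    using that by auto
  have p_diag: "p k m = penalty_mat E (\<rho> k) $ m $ m" if "m \<in> E \<times> UNIV" for k m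
    unfolding p_def by (rule penalty_mat_diagonal[OF edge(1)[OF that], symmetric])
  (* The monotonicity hypothesis compares penalty matrices whose block size is a type of its own;
     scalar inequalities read off the diagonal carry over to the present block size. *)
  have \<rho>_mono: "\<rho> k i j \<le> \<rho> (Suc k) i j" if "(i, j) \<in> E" for k i j
    using loewner_le_diagonal[OF assms(11)[of k], of "((i, j), undefined)"] that
    by (simp add: penalty_mat_diagonal)
  have p_mono: "p k m \<le> p (Suc k) m" if "m \<in> E \<times> UNIV" for k m
    unfolding p_def by (rule \<rho>_mono[OF edge(2)[OF that]])
  have dom: "(\<Sum>m\<in>E \<times> UNIV. p k m * (incidence E $ m \<bullet> z)\<^sup>2) + c * (norm z)\<^sup>2 \<le> z \<bullet> Q z" for k z
  proof -
    let ?v = "incidence E *v z :: real^(('n \<times> 'n) \<times> 'd)"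
    have "(\<Sum>m\<in>E \<times> UNIV. p k m * (incidence E $ m \<bullet> z)\<^sup>2)
        \<le> (\<Sum>m\<in>E \<times> UNIV. p (Suc k) m * (incidence E $ m \<bullet> z)\<^sup>2)"
      by (intro sum_mono mult_right_mono p_mono) auto
    also have "\<dots> = ?v \<bullet> (penalty_mat E (\<rho> (Suc k)) *v ?v)"
      by (simp add: penalty_quadratic_form incidence_mult_nth p_def)
    also have "\<dots> \<le> ?v \<bullet> (R *v ?v)"
      using assms(12)[of k] incidence_mult_edge_vecs[of E z]
      by (simp add: loewner_le_def matrix_vector_mult_diff_rdistrib inner_diff_right)
    also have "\<dots> = z \<bullet> ((transpose (incidence E) ** R ** incidence E) *v z)"
      unfolding matrix_vector_mul_assoc[symmetric] transpose_matrix_vector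
      by (metis dot_lmul_matrix inner_commute)
    finally show ?thesis
      using coercive[of z] by (simp add: matrix_vector_mult_diff_rdistrib inner_diff_right Q_eq)
  qed
  have row: "incidence E $ ((i, j), d) \<bullet> z = z $ (i, d) - z $ (j, d)" if "(i, j) \<in> E" for i j and d :: 'd and z
    using incidence_row[of "(i, j)" E d z] orient[OF that] that by simp
  have step: "stacked_gradient g (x (Suc k)) + Q (x (Suc k) - x k)
      + (\<Sum>m\<in>E \<times> UNIV. (lam k m + p k m * (incidence E $ m \<bullet> x k)) *\<^sub>R incidence E $ m) = 0" for k
  proof -
    have "(stacked_gradient g (x (Suc k)) + Q (x (Suc k) - x k)
      + (\<Sum>m\<in>E \<times> UNIV. (lam k m + p k m * (incidence E $ m \<bullet> x k)) *\<^sub>R incidence E $ m)) $ (i, d) = 0" for i d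
    proof -
      define h where "h i j = (l k i j + \<rho> k i j *\<^sub>R (block (x k) i - block (x k) j)) $ d" for i j
      have "(\<Sum>m\<in>E \<times> UNIV. (lam k m + p k m * (incidence E $ m \<bullet> x k)) *\<^sub>R incidence E $ m) $ (i, d)
          = (\<Sum>j\<in>nbrs E i - {i}. h i j)"
        by (rule transpose_incidence_nth)
          (use orient in \<open>auto simp: h_def lam_def p_def row l_antisym \<rho>_sym algebra_simps\<close>)
      moreover have "(g i (block (x (Suc k)) i) + (\<gamma> i + 1) *\<^sub>R (block (x (Suc k)) i - block (x k) i)
          + (\<Sum>j\<in>nbrs E i - {i}. l k i j + \<rho> k i j *\<^sub>R (block (x k) i - block (x k) j))) $ d = 0"
        by (subst agent_step_stationarity[OF grad pen l_diag min]) simp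
      ultimately show ?thesis
        by (simp add: h_def stacked_gradient_def Q_def)
    qed
    then show ?thesis
      by (simp add: vec_eq_iff)
  qed
  have lam_step: "lam (Suc k) m = lam k m + p (Suc k) m * (incidence E $ m \<bullet> x (Suc k))"
    if "m \<in> E \<times> UNIV" for k m
  proof -
    obtain i j d where m: "m = ((i, j), d)" by (metis prod.collapse)
    then have "(i, j) \<in> E" using that by simp
    moreover from this have "j \<in> nbrs E i" by (simp add: nbrs_def)
    ultimately show ?thesis
      by (simp add: m lam_def p_def row l_step)
  qed
  have linQ: "linear Q"
    by (rule linearI) (simp_all add: Q_def vec_eq_iff algebra_simps)
  have symQ: "u \<bullet> Q v = Q u \<bullet> v" for u v
    by (simp add: Q_def inner_vec_def algebra_simps)
  have "\<exists>y mu. x \<longlonglongrightarrow> y \<and> (\<forall>m\<in>E \<times> UNIV. incidence E $ m \<bullet> y = 0) \<and>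
      stacked_gradient g y + (\<Sum>m\<in>E \<times> UNIV. mu m *\<^sub>R incidence E $ m) = 0"
  proof (rule primal_dual_convergence[where G = "stacked_gradient g" and Q = Q and M = "E \<times> UNIV"
        and a = "\<lambda>m. incidence E $ m" and p = p and lam = lam and x = x
        and xs = xs and ls = "\<lambda>m. ls $ m" and c = c and b = "\<lambda>m. R $ m $ m"])
    show "0 \<le> (stacked_gradient g u - stacked_gradient g v) \<bullet> (u - v)" for u v
      by (rule stacked_gradient_monotone[OF assms(2) grad])
    show "0 < p 0 m" if "m \<in> E \<times> UNIV" for m
      unfolding p_def by (rule \<rho>_pos[OF edge(2)[OF that]])
    show "p k m \<le> p (Suc k) m" if "m \<in> E \<times> UNIV" for k m
      by (rule p_mono[OF that])
    show "p k m \<le> R $ m $ m" if "m \<in> E \<times> UNIV" for k m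
    proof -
      have "p (Suc k) m \<le> R $ m $ m"
        unfolding p_diag[OF that] by (rule loewner_le_diagonal[OF assms(12) edge(1)[OF that]])
      with p_mono[OF that, of k] show ?thesis by linarith
    qed
    show "incidence E $ m \<bullet> xs = 0" if "m \<in> E \<times> UNIV" for m
      by (rule saddle_point_imp_KKT(1)[OF grad saddle that])
    show "stacked_gradient g xs + (\<Sum>m\<in>E \<times> UNIV. ls $ m *\<^sub>R incidence E $ m) = 0"
      by (rule saddle_point_imp_KKT(2)[OF grad saddle])
  qed (rule continuous_stacked_gradient[OF contg] linQ symQ c dom step | rule lam_step, assumption)+
  then obtain y mu where lim: "x \<longlonglongrightarrow> y"
    and KKT: "\<And>m. m \<in> E \<times> UNIV \<Longrightarrow> incidence E $ m \<bullet> y = 0"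
      "stacked_gradient g y + (\<Sum>m\<in>E \<times> UNIV. mu m *\<^sub>R incidence E $ m) = 0"
    by blast
  have "optimal_solution E f y"
    by (rule KKT_imp_optimal_solution[OF assms(2) grad KKT])
  with lim show ?thesis by blast
qed

end
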